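(* $\mathrm{NID}\notin\Pi_2$.
   Context: Fix a universal prefix-free machine $U$. $K$ denotes prefix-free Kolmogorov complexity and $K(x\mid y)$ conditional prefix-free complexity. For binary strings $x,y$ let $E(x,y)=\max\{K(x\mid y),K(y\mid x)\}$ and $\mathrm{NID}(x,y)=\dfrac{E(x,y)}{\max\{K(x),K(y)\}}$, a rational-valued function on pairs of strings. The oscillation classes: an approximation of $F$ is a computable $f$ with $\lim_{s\to\infty}f(z,s)=F(z)$ for all $z$; $F\in\Sigma_1$ if it has an approximation nondecreasing in $s$; $F\in\Pi_1$ if it has one nonincreasing in $s$; $F\in\Sigma_{n+1}$ if it has a computable approximation $f$ such that for every $z$ there is $s_z$ with $f(z,t)$ nondecreasing for $t<s_z$ and $(f(z,t))_{t\geq s_z}$ a $\Pi_n$-approximation; $F\in\Pi_{n+1}$ likewise with nonincreasing for $t<s_z$ and $(f(z,t))_{t\geq s_z}$ a $\Sigma_n$-approximation. So $\Pi_2$ means an approximation that on each input first goes down (nonincreasing) and then goes up (nondecreasing). *)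

theory Defs
  imports Complex_Main "HOL-Library.Nat_Bijection"
begin

datatype recf = Zf | Sf | Idf nat | Cnf recf "recf list" | Prf recf recf | Mnf recf

inductive rec_eval :: "recf \<Rightarrow> nat list \<Rightarrow> nat \<Rightarrow> bool" where
  zero: "rec_eval Zf xs 0"
| succ: "rec_eval Sf (x # xs) (Suc x)"
| proj: "i < length xs \<Longrightarrow> rec_eval (Idf i) xs (xs ! i)"
| comp: "list_all2 (\<lambda>g v. rec_eval g xs v) gs ys \<Longrightarrow> rec_eval f ys z
          \<Longrightarrow> rec_eval (Cnf f gs) xs z"
| pr0: "rec_eval f xs y \<Longrightarrow> rec_eval (Prf f g) (0 # xs) y"
| prS: "rec_eval (Prf f g) (n # xs) y \<Longrightarrow> rec_eval g (n # y # xs) z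
          \<Longrightarrow> rec_eval (Prf f g) (Suc n # xs) z"
| mn: "rec_eval f (n # xs) 0 \<Longrightarrow> (\<forall>m<n. \<exists>k. k > 0 \<and> rec_eval f (m # xs) k)
          \<Longrightarrow> rec_eval (Mnf f) xs n"

text \<open>Bijective base-2 coding of binary strings (bool lists) by naturals.\<close>
fun bits_code :: "bool list \<Rightarrow> nat" where
  "bits_code [] = 0"
| "bits_code (b # bs) = (if b then 2 else 1) + 2 * bits_code bs"

definition rat_of_code :: "nat \<Rightarrow> rat" where
  "rat_of_code n = (case prod_decode n of (a, b) \<Rightarrow> of_int (int_decode a) / of_nat (Suc b))"

text \<open>A (conditional) machine maps a program p and a condition y to an optional output.\<close>
type_synonym machine = "bool list \<Rightarrow> bool list \<Rightarrow> bool list option"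

definition partial_computable :: "machine \<Rightarrow> bool" where
  "partial_computable M \<longleftrightarrow> (\<exists>r. \<forall>p y v.
      rec_eval r [bits_code p, bits_code y] v \<longleftrightarrow> (\<exists>x. M p y = Some x \<and> v = bits_code x))"

definition prefix_free_machine :: "machine \<Rightarrow> bool" where
  "prefix_free_machine M \<longleftrightarrow> partial_computable M \<and>
     (\<forall>y p r. M p y \<noteq> None \<longrightarrow> M (p @ r) y \<noteq> None \<longrightarrow> r = [])"

definition universal_pf_machine :: "machine \<Rightarrow> bool" where
  "universal_pf_machine U \<longleftrightarrow> prefix_free_machine U \<and>
     (\<forall>M. prefix_free_machine M \<longrightarrow> (\<exists>\<sigma>. \<forall>p y. U (\<sigma> @ p) y = M p y))"

definition Kc :: "machine \<Rightarrow> bool list \<Rightarrow> bool list \<Rightarrow> nat" where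
  "Kc U x y = (LEAST n. \<exists>p. length p = n \<and> U p y = Some x)"

definition K :: "machine \<Rightarrow> bool list \<Rightarrow> nat" where
  "K U x = Kc U x []"

definition E :: "machine \<Rightarrow> bool list \<Rightarrow> bool list \<Rightarrow> nat" where
  "E U x y = max (Kc U x y) (Kc U y x)"

definition NID :: "machine \<Rightarrow> bool list \<Rightarrow> bool list \<Rightarrow> rat" where
  "NID U x y = of_nat (E U x y) / of_nat (max (K U x) (K U y))"

definition computable_approx :: "(bool list \<Rightarrow> bool list \<Rightarrow> nat \<Rightarrow> rat) \<Rightarrow> bool" where
  "computable_approx f \<longleftrightarrow> (\<exists>r. \<forall>x y s. \<exists>v.
      rec_eval r [bits_code x, bits_code y, s] v \<and> f x y s = rat_of_code v)"

definition in_Pi2 :: "(bool list \<Rightarrow> bool list \<Rightarrow> rat) \<Rightarrow> bool" where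
  "in_Pi2 F \<longleftrightarrow> (\<exists>f. computable_approx f \<and>
     (\<forall>x y. (\<lambda>s. real_of_rat (f x y s)) \<longlonglongrightarrow> real_of_rat (F x y)) \<and>
     (\<forall>x y. \<exists>s0.
        (\<forall>t t'. t \<le> t' \<longrightarrow> t' < s0 \<longrightarrow> f x y t' \<le> f x y t) \<and>
        (\<forall>t t'. s0 \<le> t \<longrightarrow> t \<le> t' \<longrightarrow> f x y t \<le> f x y t')))"

end

theory Submission
  imports Defs
begin

text \<open>
  Suppose \<open>f\<close> approximates NID, first descending and then ascending. We build a prefix-free machine that
  forces \<open>f\<close> below \<open>2/3\<close>, above \<open>2/3\<close>, and below \<open>2/3\<close> again on some pair. Fix \<open>n\<close> and consider strings
  \<open>uv\<close> with \<open>|u| = |v| = n\<close>. For some \<open>u\<close> and at least three quarters of the \<open>v\<close>, \<open>K(uv)\<close> is about \<open>2n\<close>, while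
  \<open>E(uv, uw)\<close> is at most about \<open>n\<close>; hence a search finds a prefix \<open>u\<close> and a set \<open>S\<close> of that size such that
  \<open>f(uv, uw)\<close> drops below \<open>2/3\<close> for all \<open>v, w\<close> in \<open>S\<close>. The machine then gives the single string \<open>u\<close> a short
  description, so that \<open>K(uv)\<close> is at most about \<open>n\<close>, whereas \<open>E(uv, uw)\<close> remains at least about \<open>n\<close> for most
  pairs: on these \<open>f\<close> must rise above \<open>2/3\<close>. Pairs seen to rise are matched greedily, and matched strings
  get short descriptions from each other, which costs nothing because each condition has only one partner.
  More than a quarter of all \<open>v\<close> end up matched, so some matched \<open>uv\<close> has complexity about \<open>n\<close>; its pair
  has small NID although \<open>f\<close> has already risen there.
\<close>

section \<open>A calculus of computable functions\<close>

lemma rec_eval_functional: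
  "rec_eval r xs v \<Longrightarrow> rec_eval r xs w \<Longrightarrow> v = w"
proof (induction arbitrary: w rule: rec_eval.induct)
  case (zero xs)
  then show ?case by (auto elim: rec_eval.cases)
next
  case (succ x xs)
  then show ?case by (auto elim: rec_eval.cases)
next
  case (proj i xs)
  then show ?case by (auto elim: rec_eval.cases)
next
  case (comp xs gs ys f z)
  from comp.prems obtain ys' where ys': "list_all2 (\<lambda>g v. rec_eval g xs v) gs ys'" "rec_eval f ys' w"
    by (auto elim: rec_eval.cases)
  have "ys = ys'"
    using comp.IH(1) ys'(1) by (auto simp: list_all2_conv_all_nth intro!: nth_equalityI)
  then show ?case using comp.IH(2) ys'(2) by simp
next
  case (pr0 f xs y g)
  from pr0.prems have "rec_eval f xs w" by (auto elim: rec_eval.cases)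
  then show ?case by (rule pr0.IH)
next
  case (prS f g n xs y z)
  from prS.prems obtain y' where "rec_eval (Prf f g) (n # xs) y'" "rec_eval g (n # y' # xs) w"
    by (auto elim: rec_eval.cases)
  then show ?case using prS.IH by metis
next
  case (mn f n xs)
  from mn.prems have w: "rec_eval f (w # xs) 0" "\<forall>m<w. \<exists>k>0. rec_eval f (m # xs) k"
    by (auto elim: rec_eval.cases)
  have "\<not> n < w" using w(2) mn.IH(1) by fastforce
  moreover have "\<not> w < n" using w(1) mn.IH(2) by fastforce
  ultimately show ?case by simp
qed

text \<open>The map \<^term>\<open>ev\<close> lists the arguments of a function, so that the same closure rules
  serve every arity.\<close>

definition computable_in :: "('a \<Rightarrow> nat list) \<Rightarrow> ('a \<Rightarrow> nat) \<Rightarrow> bool" where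
  "computable_in ev g \<longleftrightarrow> (\<exists>r. \<forall>z. rec_eval r (ev z) (g z))"

lemma rec_eval_Cnf1:
  "rec_eval g xs a \<Longrightarrow> rec_eval f [a] z \<Longrightarrow> rec_eval (Cnf f [g]) xs z"
  by (rule rec_eval.comp[where ys = "[a]"]) auto

lemma rec_eval_Cnf2:
  "rec_eval g xs a \<Longrightarrow> rec_eval h xs b \<Longrightarrow> rec_eval f [a, b] z \<Longrightarrow> rec_eval (Cnf f [g, h]) xs z"
  by (rule rec_eval.comp[where ys = "[a, b]"]) auto

lemma rec_eval_Cnf3:
  "rec_eval g xs a \<Longrightarrow> rec_eval h xs b \<Longrightarrow> rec_eval k xs c \<Longrightarrow> rec_eval f [a, b, c] z
    \<Longrightarrow> rec_eval (Cnf f [g, h, k]) xs z"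
  by (rule rec_eval.comp[where ys = "[a, b, c]"]) auto

lemma computable_in_comp1:
  assumes "computable_in (\<lambda>x. [x]) g" "computable_in ev a"
  shows "computable_in ev (\<lambda>z. g (a z))"
  using assms unfolding computable_in_def by (meson rec_eval_Cnf1)

lemma computable_in_comp2:
  assumes "computable_in (\<lambda>(x, y). [x, y]) (\<lambda>(x, y). g x y)" "computable_in ev a" "computable_in ev b"
  shows "computable_in ev (\<lambda>z. g (a z) (b z))"
proof -
  from assms(1) obtain r where "\<And>x y. rec_eval r [x, y] (g x y)"
    unfolding computable_in_def by auto
  then show ?thesis
    using assms(2,3) unfolding computable_in_def by (meson rec_eval_Cnf2)
qed

lemma computable_in_comp3:
  assumes "computable_in (\<lambda>(x, y, w). [x, y, w]) (\<lambda>(x, y, w). g x y w)"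
    "computable_in ev a" "computable_in ev b" "computable_in ev c"
  shows "computable_in ev (\<lambda>z. g (a z) (b z) (c z))"
proof -
  from assms(1) obtain r where "\<And>x y w. rec_eval r [x, y, w] (g x y w)"
    unfolding computable_in_def by auto
  then show ?thesis
    using assms(2-4) unfolding computable_in_def by (meson rec_eval_Cnf3)
qed

lemma computable_in_nth:
  assumes "\<And>z. i < length (ev z)" "\<And>z. ev z ! i = g z"
  shows "computable_in ev g"
  unfolding computable_in_def using assms by (metis rec_eval.proj)

lemma computable_in_Suc: "computable_in ev a \<Longrightarrow> computable_in ev (\<lambda>z. Suc (a z))"
  unfolding computable_in_def by (meson rec_eval_Cnf1 rec_eval.succ)

lemma computable_in_const: "computable_in ev (\<lambda>z. c)"
proof (induction c)
  case 0
  show ?case unfolding computable_in_def by (meson rec_eval.zero)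
next
  case (Suc c)
  then show ?case by (rule computable_in_Suc)
qed

lemma computable_in_rec2:
  assumes "computable_in (\<lambda>x. [x]) a"
    and "computable_in (\<lambda>(i, acc, x). [i, acc, x]) (\<lambda>(i, acc, x). h i acc x)"
  shows "computable_in (\<lambda>(m, x). [m, x]) (\<lambda>(m, x). rec_nat (a x) (\<lambda>i acc. h i acc x) m)"
proof -
  from assms obtain ra rh where r: "\<And>x. rec_eval ra [x] (a x)"
    "\<And>i acc x. rec_eval rh [i, acc, x] (h i acc x)"
    unfolding computable_in_def by auto
  have "rec_eval (Prf ra rh) [m, x] (rec_nat (a x) (\<lambda>i acc. h i acc x) m)" for m x
    by (induction m) (auto intro: rec_eval.pr0 rec_eval.prS r)
  then show ?thesis unfolding computable_in_def by auto
qed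

lemma computable_in_rec:
  assumes "computable_in (\<lambda>x. [x]) a"
    and "computable_in (\<lambda>(i, acc, x). [i, acc, x]) (\<lambda>(i, acc, x). h i acc x)"
    and "computable_in ev b" "computable_in ev c"
  shows "computable_in ev (\<lambda>z. rec_nat (a (c z)) (\<lambda>i acc. h i acc (c z)) (b z))"
  using computable_in_comp2[OF computable_in_rec2[OF assms(1,2)] assms(3,4)] .

lemma computable_in_arg3:
  "computable_in (\<lambda>(i, acc, x). [i, acc, x]) (\<lambda>(i, acc, x). i)"
  "computable_in (\<lambda>(i, acc, x). [i, acc, x]) (\<lambda>(i, acc, x). acc)"
  "computable_in (\<lambda>(i, acc, x). [i, acc, x]) (\<lambda>(i, acc, x). x)"
  by (rule computable_in_nth[where i = 0] computable_in_nth[where i = 1]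
      computable_in_nth[where i = 2]; auto)+

lemma computable_in_id: "computable_in (\<lambda>x. [x]) (\<lambda>x. x)"
  by (rule computable_in_nth[where i = 0]) auto

lemma computable_in_add:
  assumes "computable_in ev a" "computable_in ev b"
  shows "computable_in ev (\<lambda>z. a z + b z)"
proof -
  have *: "rec_nat x (\<lambda>i acc. Suc acc) m = m + x" for m x by (induction m) auto
  show ?thesis
    using computable_in_rec[OF computable_in_id, of "\<lambda>i acc x. Suc acc", OF _ assms]
      computable_in_Suc[OF computable_in_arg3(2)]
    unfolding * by (simp add: case_prod_unfold)
qed

lemma computable_in_mult:
  assumes "computable_in ev a" "computable_in ev b"
  shows "computable_in ev (\<lambda>z. a z * b z)"
proof -
  have *: "rec_nat 0 (\<lambda>i acc. acc + x) m = m * x" for m x :: nat by (induction m) auto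
  show ?thesis
    using computable_in_rec[OF computable_in_const, of "\<lambda>i acc x. acc + x" _ _ _ 0, OF _ assms]
      computable_in_add[OF computable_in_arg3(2,3)]
    unfolding * by (simp add: case_prod_unfold)
qed

lemma computable_in_power:
  assumes "computable_in ev a" "computable_in ev b"
  shows "computable_in ev (\<lambda>z. a z ^ b z)"
proof -
  have *: "rec_nat 1 (\<lambda>i acc. acc * x) m = x ^ m" for m x :: nat by (induction m) auto
  show ?thesis
    using computable_in_rec[OF computable_in_const, of "\<lambda>i acc x. acc * x" _ _ _ 1, OF _ assms(2,1)]
      computable_in_mult[OF computable_in_arg3(2,3)]
    unfolding * by (simp add: case_prod_unfold)
qed

lemma computable_in_pred:
  assumes "computable_in ev a"
  shows "computable_in ev (\<lambda>z. a z - 1)"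
proof -
  have *: "rec_nat 0 (\<lambda>i acc. i) m = m - 1" for m by (induction m) auto
  show ?thesis
    using computable_in_rec[OF computable_in_const, of "\<lambda>i acc x. i" _ _ _ 0,
        OF computable_in_arg3(1) assms assms]
    unfolding * .
qed

lemma computable_in_diff:
  assumes "computable_in ev a" "computable_in ev b"
  shows "computable_in ev (\<lambda>z. a z - b z)"
proof -
  have *: "rec_nat x (\<lambda>i acc. acc - 1) m = x - m" for m x :: nat by (induction m) auto
  show ?thesis
    using computable_in_rec[OF computable_in_id, of "\<lambda>i acc x. acc - 1", OF _ assms(2,1)]
      computable_in_pred[OF computable_in_arg3(2)]
    unfolding * by (simp add: case_prod_unfold)
qed

lemma computable_in_triangle:
  assumes "computable_in ev a"
  shows "computable_in ev (\<lambda>z. triangle (a z))"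
proof -
  have *: "rec_nat 0 (\<lambda>i acc. acc + Suc i) m = triangle m" for m by (induction m) auto
  show ?thesis
    using computable_in_rec[OF computable_in_const, of "\<lambda>i acc x. acc + Suc i" _ _ _ 0, OF _ assms assms]
      computable_in_add[OF computable_in_arg3(2) computable_in_Suc[OF computable_in_arg3(1)]]
    unfolding * by (simp add: case_prod_unfold)
qed

section \<open>Cantor pairing and its projections\<close>

abbreviation pair :: "nat \<Rightarrow> nat \<Rightarrow> nat" where
  "pair a b \<equiv> prod_encode (a, b)"

abbreviation pr1 :: "nat \<Rightarrow> nat" where
  "pr1 z \<equiv> fst (prod_decode z)"

abbreviation pr2 :: "nat \<Rightarrow> nat" where
  "pr2 z \<equiv> snd (prod_decode z)"

lemma pair_collapse: "triangle (pr1 z + pr2 z) + pr1 z = z"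
  using prod_decode_inverse[of z] by (simp add: prod_encode_def case_prod_unfold)

lemma computable_in_pair:
  "computable_in ev a \<Longrightarrow> computable_in ev b \<Longrightarrow> computable_in ev (\<lambda>z. pair (a z) (b z))"
  unfolding prod_encode_def by (simp add: computable_in_add computable_in_triangle)

text \<open>The number \<^term>\<open>m\<close> lies on the diagonal of index \<^term>\<open>pr1 m + pr2 m\<close> of the Cantor pairing,
  and this index is computed by counting the diagonals passed so far.\<close>

lemma diagonal_index:
  "rec_nat 0 (\<lambda>i k. k + (1 - (triangle (Suc k) - Suc i))) m = pr1 m + pr2 m"
proof (induction m)
  case 0
  have "(0 :: nat) = pair 0 0" by (simp add: prod_encode_def)
  then have "prod_decode 0 = (0, 0)" by (metis prod_encode_inverse)
  then show ?case by simp
next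
  case (Suc m)
  define a b where "a = pr1 m" and "b = pr2 m"
  have m: "m = triangle (a + b) + a"
    using pair_collapse[of m] unfolding a_def b_def by simp
  show ?case
  \<comment> \<open>Exactly for \<open>b = 0\<close> is \<open>m\<close> the last number on its
    diagonal; then the truncated difference vanishes and the increment is 1.\<close>
  proof (cases b)
    case 0
    have "Suc m = pair 0 (Suc a)" using m 0 by (simp add: prod_encode_def)
    then have "pr1 (Suc m) + pr2 (Suc m) = Suc a" by simp
    moreover have "triangle (Suc (a + b)) - Suc m = 0" using m 0 by simp
    ultimately show ?thesis using Suc 0 unfolding a_def[symmetric] b_def[symmetric] by simp
  next
    case (Suc b')
    have "Suc m = pair (Suc a) b'" using m Suc by (simp add: prod_encode_def)
    then have "pr1 (Suc m) + pr2 (Suc m) = a + b" using Suc by simp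
    moreover have "triangle (Suc (a + b)) - Suc m > 0" using m Suc by simp
    ultimately show ?thesis using Suc.IH unfolding a_def[symmetric] b_def[symmetric] by simp
  qed
qed

lemma computable_in_diagonal_index:
  assumes "computable_in ev a"
  shows "computable_in ev (\<lambda>z. pr1 (a z) + pr2 (a z))"
proof -
  have "computable_in (\<lambda>(i, acc, x). [i, acc, x])
    (\<lambda>z. fst (snd z) + (1 - (triangle (Suc (fst (snd z))) - Suc (fst z))))"
    using computable_in_arg3 unfolding case_prod_unfold
    by (intro computable_in_add computable_in_diff computable_in_const computable_in_triangle
        computable_in_Suc) auto
  then have "computable_in (\<lambda>(i, acc, x). [i, acc, x])
    (\<lambda>(i, k, x). k + (1 - (triangle (Suc k) - Suc i)))"
    by (simp add: case_prod_unfold)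
  from computable_in_rec[OF computable_in_const this assms assms, of 0]
  show ?thesis by (simp only: diagonal_index)
qed

lemma computable_in_pr1:
  assumes "computable_in ev a"
  shows "computable_in ev (\<lambda>z. pr1 (a z))"
proof -
  have "pr1 m = m - triangle (pr1 m + pr2 m)" for m
    using pair_collapse[of m] by linarith
  then have "(\<lambda>z. pr1 (a z)) = (\<lambda>z. a z - triangle (pr1 (a z) + pr2 (a z)))" by auto
  then show ?thesis
    using computable_in_diff[OF assms computable_in_triangle[OF computable_in_diagonal_index[OF assms]]]
    by simp
qed

lemma computable_in_pr2:
  assumes "computable_in ev a"
  shows "computable_in ev (\<lambda>z. pr2 (a z))"
  using computable_in_diff[OF computable_in_diagonal_index[OF assms] computable_in_pr1[OF assms]]
  by simp

section \<open>Decidable predicates and bounded quantifiers\<close>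

abbreviation computable :: "(nat \<Rightarrow> nat) \<Rightarrow> bool" where
  "computable \<equiv> computable_in (\<lambda>x. [x])"

definition decidable :: "(nat \<Rightarrow> bool) \<Rightarrow> bool" where
  "decidable P \<longleftrightarrow> computable (\<lambda>x. of_bool (P x))"

text \<open>Packing index, accumulator and parameter into one number keeps all later closure rules
  unary.\<close>

lemma computable_rec:
  assumes "computable a" "computable (\<lambda>z. h (pr1 z) (pr1 (pr2 z)) (pr2 (pr2 z)))" "computable b"
  shows "computable (\<lambda>x. rec_nat (a x) (\<lambda>i acc. h i acc x) (b x))"
proof -
  have "computable_in (\<lambda>(i, acc, x). [i, acc, x]) (\<lambda>z. pair (fst z) (pair (fst (snd z)) (snd (snd z))))"
    using computable_in_arg3 by (intro computable_in_pair) (simp_all add: case_prod_unfold)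
  from computable_in_comp1[OF assms(2) this]
  have "computable_in (\<lambda>(i, acc, x). [i, acc, x]) (\<lambda>(i, acc, x). h i acc x)"
    by (simp add: case_prod_unfold)
  from computable_in_rec[OF assms(1) this assms(3) computable_in_id] show ?thesis .
qed

lemma decidable_not:
  assumes "decidable P"
  shows "decidable (\<lambda>x. \<not> P x)"
proof -
  have *: "of_bool (\<not> Q) = (1 :: nat) - of_bool Q" for Q by simp
  show ?thesis
    using assms unfolding decidable_def * by (intro computable_in_diff computable_in_const)
qed

lemma decidable_conj: "decidable P \<Longrightarrow> decidable Q \<Longrightarrow> decidable (\<lambda>x. P x \<and> Q x)"
  unfolding decidable_def of_bool_conj by (rule computable_in_mult)

lemma decidable_disj:
  assumes "decidable P" "decidable Q"
  shows "decidable (\<lambda>x. P x \<or> Q x)"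
  using decidable_not[OF decidable_conj[OF assms[THEN decidable_not]]] by simp

lemma decidable_imp:
  assumes "decidable P" "decidable Q"
  shows "decidable (\<lambda>x. P x \<longrightarrow> Q x)"
  using decidable_disj[OF decidable_not[OF assms(1)] assms(2)] by (simp only: imp_conv_disj)

lemma decidable_iff:
  assumes "decidable P" "decidable Q"
  shows "decidable (\<lambda>x. P x \<longleftrightarrow> Q x)"
  using decidable_conj[OF decidable_imp[OF assms] decidable_imp[OF assms(2,1)]]
  by (simp only: iff_conv_conj_imp)

lemma decidable_less:
  assumes "computable a" "computable b"
  shows "decidable (\<lambda>x. a x < b x)"
proof -
  have *: "of_bool (m < n) = 1 - (1 - (n - m))" for m n :: nat by auto
  show ?thesis unfolding decidable_def *
    by (intro computable_in_diff computable_in_const assms)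
qed

lemma decidable_le:
  assumes "computable a" "computable b"
  shows "decidable (\<lambda>x. a x \<le> b x)"
  using decidable_not[OF decidable_less[OF assms(2,1)]] by (simp only: not_less)

lemma decidable_eq:
  assumes "computable a" "computable b"
  shows "decidable (\<lambda>x. a x = b x)"
  using decidable_conj[OF decidable_le[OF assms] decidable_le[OF assms(2,1)]]
  by (simp only: order_eq_iff)

text \<open>Bounded counting expresses the size condition on cliques and, by comparison with 0, the
  bounded quantifiers.\<close>

lemma computable_card:
  assumes "computable b" "decidable (\<lambda>z. Q (pr1 z) (pr2 z))"
  shows "computable (\<lambda>x. card {i. i < b x \<and> Q i x})"
proof -
  have *: "rec_nat 0 (\<lambda>i acc. acc + of_bool (Q i x)) m = card {i. i < m \<and> Q i x}" for m x
  proof (induction m)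
    case (Suc m)
    have "{i. i < Suc m \<and> Q i x} = (if Q m x then {m} else {}) \<union> {i. i < m \<and> Q i x}"
      by (auto simp: less_Suc_eq)
    then show ?case using Suc by auto
  qed simp
  have "computable (\<lambda>z. of_bool (Q (pr1 (pair (pr1 z) (pr2 (pr2 z)))) (pr2 (pair (pr1 z) (pr2 (pr2 z))))))"
    using assms(2) unfolding decidable_def
    by (rule computable_in_comp1)
      (intro computable_in_pair computable_in_pr1 computable_in_pr2 computable_in_id)
  then have "computable (\<lambda>z. pr1 (pr2 z) + of_bool (Q (pr1 z) (pr2 (pr2 z))))"
    by (intro computable_in_add computable_in_pr1 computable_in_pr2 computable_in_id) simp
  from computable_rec[OF computable_in_const this assms(1), of 0] show ?thesis
    unfolding * .
qed

lemma decidable_ex_less: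
  assumes "computable b" "decidable (\<lambda>z. Q (pr1 z) (pr2 z))"
  shows "decidable (\<lambda>x. \<exists>i<b x. Q i x)"
proof -
  have "(\<exists>i<b x. Q i x) \<longleftrightarrow> 0 < card {i. i < b x \<and> Q i x}" for x
    by (auto simp: card_gt_0_iff)
  then show ?thesis
    using decidable_less[OF computable_in_const computable_card[OF assms], of 0] by simp
qed

lemma decidable_all_less:
  assumes "computable b" "decidable (\<lambda>z. Q (pr1 z) (pr2 z))"
  shows "decidable (\<lambda>x. \<forall>i<b x. Q i x)"
  using decidable_not[OF decidable_ex_less[OF assms(1) decidable_not[OF assms(2)]]] by simp

lemmas computable_intros =
  computable_in_id computable_in_const computable_in_Suc computable_in_add computable_in_mult
  computable_in_power computable_in_diff computable_in_pair computable_in_pr1 computable_in_pr2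
  computable_card decidable_not decidable_conj decidable_disj decidable_imp decidable_iff
  decidable_less decidable_le decidable_eq decidable_ex_less decidable_all_less

text \<open>A bounded search for the higher part \<open>h\<close> and the remainder \<open>l\<close>
  isolates bit \<open>i\<close> using only sums, products and powers.\<close>

lemma decidable_set_decode:
  assumes "computable a" "computable b"
  shows "decidable (\<lambda>x. a x \<in> set_decode (b x))"
proof -
  have *: "i \<in> set_decode S \<longleftrightarrow> (\<exists>h<Suc S. \<exists>l<2 ^ i. S = (2 * h + 1) * 2 ^ i + l)" for i S
  proof
    assume "i \<in> set_decode S"
    then have "odd (S div 2 ^ i)" by (simp add: set_decode_def)
    then obtain h where h: "S div 2 ^ i = 2 * h + 1" by (elim oddE)
    have "S = (2 * h + 1) * 2 ^ i + S mod 2 ^ i"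
      unfolding h[symmetric] by (rule div_mult_mod_eq[symmetric])
    moreover have "h < Suc S" using h div_le_dividend[of S "2 ^ i"] by linarith
    moreover have "S mod 2 ^ i < 2 ^ i" by simp
    ultimately show "\<exists>h<Suc S. \<exists>l<2 ^ i. S = (2 * h + 1) * 2 ^ i + l" by blast
  next
    assume "\<exists>h<Suc S. \<exists>l<2 ^ i. S = (2 * h + 1) * 2 ^ i + l"
    then obtain h l where "l < 2 ^ i" "S = (2 * h + 1) * 2 ^ i + l" by blast
    then have "S div 2 ^ i = 2 * h + 1" by (metis div_mult_self3 div_less power_not_zero add_0_right zero_neq_numeral)
    then show "i \<in> set_decode S" by (simp add: set_decode_def)
  qed
  show ?thesis unfolding *
    by (intro computable_intros computable_in_comp1[OF assms(1)] computable_in_comp1[OF assms(2)])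
qed

text \<open>Clearing denominators leaves a comparison of naturals. Odd numerator codes stand for
  negative integers, which always lie below the threshold.\<close>

lemma decidable_rat_of_code:
  assumes "computable a"
  shows "decidable (\<lambda>x. rat_of_code (a x) < 2 / 3)" "decidable (\<lambda>x. 2 / 3 < rat_of_code (a x))"
proof -
  have dec: "int_decode (2 * h) = int h" "int_decode (Suc (2 * h)) = - int h - 1" for h
    by (simp_all add: int_decode_def sum_decode_def)
  have low: "rat_of_code m < 2 / 3 \<longleftrightarrow>
    (\<exists>h<Suc (pr1 m). pr1 m = Suc (2 * h) \<or> pr1 m = 2 * h \<and> 3 * h < 2 * Suc (pr2 m))" for m
  proof -
    obtain c b where cb: "prod_decode m = (c, b)" by fastforce
    consider h where "c = 2 * h" | h where "c = Suc (2 * h)" by (metis oddE evenE Suc_eq_plus1)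
    then show ?thesis
    proof cases
      case 1
      have "rat_of_code m = of_nat h / of_nat (Suc b)" by (simp add: rat_of_code_def cb 1 dec)
      also have "\<dots> < 2 / 3 \<longleftrightarrow> (of_nat (3 * h) :: rat) < of_nat (2 * Suc b)"
        by (simp add: field_simps)
      finally show ?thesis unfolding of_nat_less_iff using 1 by (auto simp: cb intro!: exI[of _ h]) presburger+
    next
      case 2
      have "rat_of_code m = - of_nat (Suc h) / of_nat (Suc b)" by (simp add: rat_of_code_def cb 2 dec)
      also have "\<dots> \<le> 0" by (simp add: divide_le_0_iff)
      finally show ?thesis using 2 by (auto simp: cb intro!: exI[of _ h])
    qed
  qed
  have high: "2 / 3 < rat_of_code m \<longleftrightarrow>
    (\<exists>h<Suc (pr1 m). pr1 m = 2 * h \<and> 2 * Suc (pr2 m) < 3 * h)" for m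
  proof -
    obtain c b where cb: "prod_decode m = (c, b)" by fastforce
    consider h where "c = 2 * h" | h where "c = Suc (2 * h)" by (metis oddE evenE Suc_eq_plus1)
    then show ?thesis
    proof cases
      case 1
      have "rat_of_code m = of_nat h / of_nat (Suc b)" by (simp add: rat_of_code_def cb 1 dec)
      also have "2 / 3 < \<dots> \<longleftrightarrow> (of_nat (2 * Suc b) :: rat) < of_nat (3 * h)"
        by (simp add: field_simps)
      finally show ?thesis unfolding of_nat_less_iff using 1 by (auto simp: cb intro!: exI[of _ h])
    next
      case 2
      have "rat_of_code m = - of_nat (Suc h) / of_nat (Suc b)" by (simp add: rat_of_code_def cb 2 dec)
      also have "\<dots> \<le> 0" by (simp add: divide_le_0_iff)
      finally show ?thesis using 2 by (auto simp: cb) presburger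
    qed
  qed
  show "decidable (\<lambda>x. rat_of_code (a x) < 2 / 3)" "decidable (\<lambda>x. 2 / 3 < rat_of_code (a x))"
    unfolding low high
    by (intro computable_intros computable_in_comp1[OF assms(1)])+
qed

text \<open>Minimization runs over codes of pairs \<open>(n, x)\<close>, and the second component is
  returned. The least code may carry a different \<open>n\<close>, but single-valuedness makes its
  \<open>x\<close> the same.\<close>

lemma single_valued_search:
  assumes T: "decidable (\<lambda>z. T (pr1 z) (pr1 (pr2 z)) (pr1 (pr2 (pr2 z))) (pr2 (pr2 (pr2 z))))"
    and sv: "\<And>n n' p y x x'. T n x p y \<Longrightarrow> T n' x' p y \<Longrightarrow> x = x'"
  shows "\<exists>r. \<forall>p y v. rec_eval r [p, y] v \<longleftrightarrow> (\<exists>n. T n v p y)"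
proof -
  have arg: "computable_in (\<lambda>(m, p, y). [m, p, y]) (\<lambda>z. fst z)"
    "computable_in (\<lambda>(m, p, y). [m, p, y]) (\<lambda>z. fst (snd z))"
    "computable_in (\<lambda>(m, p, y). [m, p, y]) (\<lambda>z. snd (snd z))"
    using computable_in_arg3 by (simp_all add: case_prod_unfold)
  have "computable_in (\<lambda>(m, p, y). [m, p, y])
    (\<lambda>z. pair (pr1 (fst z)) (pair (pr2 (fst z)) (pair (fst (snd z)) (snd (snd z)))))"
    by (intro computable_in_pair computable_in_pr1 computable_in_pr2 arg)
  from computable_in_comp1[OF decidable_not[OF T, unfolded decidable_def] this]
  obtain rT where rT: "\<And>m p y. rec_eval rT [m, p, y] (of_bool (\<not> T (pr1 m) (pr2 m) p y))"
    unfolding computable_in_def by auto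
  have "computable (\<lambda>x. pr2 x)" by (intro computable_intros)
  then obtain r2 where r2: "\<And>x. rec_eval r2 [x] (pr2 x)"
    unfolding computable_in_def by auto
  have fwd: "\<exists>n. T n v p y" if "rec_eval (Cnf r2 [Mnf rT]) [p, y] v" for p y v
  proof -
    from that obtain m where m: "rec_eval (Mnf rT) [p, y] m" "rec_eval r2 [m] v"
      by (auto elim!: rec_eval.cases[of "Cnf _ _"] simp: list_all2_Cons1)
    from m(1) have "rec_eval rT [m, p, y] 0" by (auto elim: rec_eval.cases)
    from rec_eval_functional[OF this rT] have "T (pr1 m) (pr2 m) p y" by (simp split: if_splits)
    moreover have "v = pr2 m" using rec_eval_functional[OF m(2) r2] .
    ultimately show ?thesis by auto
  qed
  have bwd: "rec_eval (Cnf r2 [Mnf rT]) [p, y] v" if n: "T n v p y" for n p y v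
  proof -
    define m where "m = (LEAST m. T (pr1 m) (pr2 m) p y)"
    have m: "T (pr1 m) (pr2 m) p y"
      unfolding m_def by (rule LeastI[of _ "pair n v"]) (simp add: n)
    have "rec_eval rT (m # [p, y]) 0" using rT[of m p y] m by simp
    moreover have "\<forall>i<m. \<exists>k>0. rec_eval rT (i # [p, y]) k"
    proof (intro allI impI)
      fix i assume "i < m"
      then have "\<not> T (pr1 i) (pr2 i) p y" unfolding m_def by (rule not_less_Least)
      then show "\<exists>k>0. rec_eval rT (i # [p, y]) k" using rT[of i p y] by (intro exI[of _ 1]) simp
    qed
    ultimately have "rec_eval (Mnf rT) [p, y] m" by (rule rec_eval.mn)
    moreover have "pr2 m = v" using sv[OF m n] .
    ultimately show ?thesis using r2[of m] by (auto intro: rec_eval_Cnf1)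
  qed
  show ?thesis using fwd bwd by blast
qed

section \<open>Binary strings and programs\<close>

lemma bits_code_append: "bits_code (u @ w) = bits_code u + 2 ^ length u * bits_code w"
  by (induction u) auto

lemma bits_code_bounds: "2 ^ length p \<le> Suc (bits_code p)" "Suc (bits_code p) < 2 ^ Suc (length p)"
  by (induction p) auto

lemma inj_bits_code: "inj bits_code"
proof (rule injI)
  fix p q assume "bits_code p = bits_code q"
  then show "p = q"
  proof (induction p arbitrary: q)
    case Nil
    then show ?case by (cases q) (auto split: if_splits)
  next
    case (Cons a p)
    then obtain b q' where q: "q = b # q'" by (cases q) (auto split: if_splits)
    have eq: "(if a then 2 else 1) + 2 * bits_code p = (if b then 2 else 1) + 2 * bits_code q'"
      using Cons.prems q by simp
    then have "a = b" by (cases a; cases b) (simp_all, presburger+)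
    moreover from this eq have "bits_code p = bits_code q'" by simp
    ultimately show ?case using Cons.IH q by simp
  qed
qed

lemma surj_bits_code: "surj bits_code"
proof -
  have "\<exists>p. bits_code p = n" for n
  proof (induction n rule: less_induct)
    case (less n)
    show ?case
    proof (cases n)
      case 0
      then show ?thesis by (intro exI[of _ "[]"]) simp
    next
      case (Suc m)
      then obtain p where p: "bits_code p = m div 2" using less[of "m div 2"] by (metis div_le_dividend le_imp_less_Suc)
      have "bits_code (odd m # p) = n" using p Suc by (auto elim: oddE)
      then show ?thesis by blast
    qed
  qed
  then show ?thesis by (metis surjI)
qed

definition string_of :: "nat \<Rightarrow> bool list" where
  "string_of = inv bits_code"

lemma bits_code_string_of [simp]: "bits_code (string_of n) = n"
  unfolding string_of_def by (rule surj_f_inv_f[OF surj_bits_code])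

lemma string_of_bits_code [simp]: "string_of (bits_code p) = p"
  unfolding string_of_def by (rule inv_f_f[OF inj_bits_code])

lemma string_of_eq_iff [simp]: "string_of m = string_of n \<longleftrightarrow> m = n"
  by (metis bits_code_string_of)

lemma string_of_0 [simp]: "string_of 0 = []"
  by (metis bits_code.simps(1) string_of_bits_code)

text \<open>Strings of length \<open>L\<close> have the codes \<open>2 ^ L - 1\<close> to
  \<open>2 ^ (L + 1) - 2\<close>, so \<open>b < 2 ^ L\<close> indexes them.\<close>

definition word :: "nat \<Rightarrow> nat \<Rightarrow> bool list" where
  "word L b = string_of (2 ^ L + b - 1)"

lemma Suc_bits_code_word: "Suc (bits_code (word L b)) = 2 ^ L + b"
  by (simp add: word_def)

lemma length_word:
  assumes "b < 2 ^ L"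
  shows "length (word L b) = L"
proof -
  have "(2 :: nat) ^ length (word L b) < 2 ^ Suc L" "(2 :: nat) ^ L < 2 ^ Suc (length (word L b))"
    using bits_code_bounds[of "word L b"] assms unfolding Suc_bits_code_word by auto
  then have "length (word L b) < Suc L" "L < Suc (length (word L b))"
    by (simp_all only: power_strict_increasing_iff one_less_numeral_iff semiring_norm)
  then show ?thesis by simp
qed

lemma word_eq_iff: "word L b = word L b' \<longleftrightarrow> b = b'"
  by (metis Suc_bits_code_word add_left_cancel)

text \<open>The unary header makes programs self-delimiting as soon as \<open>k\<close> determines
  \<open>L\<close>.\<close>

definition prog :: "nat \<Rightarrow> nat \<Rightarrow> nat \<Rightarrow> bool list" where
  "prog k L b = replicate k True @ False # word L b"

lemma length_prog: "b < 2 ^ L \<Longrightarrow> length (prog k L b) = k + 1 + L"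
  by (simp add: prog_def length_word)

text \<open>Recognizing a program becomes an arithmetic identity, open to the decidability rules.
  The shift by 2 absorbs the code \<open>2 ^ (k + 1) - 2\<close> of the block of ones.\<close>

lemma bits_code_prog: "bits_code (prog k L b) + 2 = 2 ^ k * (2 ^ (L + 1) + 1 + 2 * b)"
proof -
  have "bits_code (replicate k True) + 2 = 2 * 2 ^ k" by (induction k) auto
  moreover have "bits_code (prog k L b) = bits_code (replicate k True) + 2 ^ k * (1 + 2 * bits_code (word L b))"
    by (simp add: prog_def bits_code_append)
  moreover have w: "2 ^ (L + 1) + 1 + 2 * b = 1 + 2 * bits_code (word L b) + 2"
    using Suc_bits_code_word[of L b] by simp
  ultimately show ?thesis unfolding w distrib_left[of _ _ 2] by linarith
qed

lemma prog_append_eq: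
  assumes "prog k L b @ r = prog k' L' b'"
  shows "k = k' \<and> word L b @ r = word L' b'"
proof -
  have *: "replicate k True @ False # u = replicate k' True @ False # w \<Longrightarrow> k = k' \<and> u = w" for u w
  proof (induction k arbitrary: k')
    case 0
    then show ?case by (cases k') auto
  next
    case (Suc k)
    then show ?case by (cases k') auto
  qed
  have "replicate k True @ False # (word L b @ r) = replicate k' True @ False # word L' b'"
    using assms by (simp add: prog_def)
  then show ?thesis by (rule *)
qed

section \<open>Greedy matchings\<close>

text \<open>Selecting in increasing order makes each choice depend on finitely many earlier ones.
  Membership in \<open>{..<e}\<close> exposes the descent needed for termination.\<close>

fun greedy :: "(nat \<Rightarrow> bool) \<Rightarrow> (nat \<Rightarrow> nat \<Rightarrow> bool) \<Rightarrow> nat \<Rightarrow> bool" where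
  "greedy R C e \<longleftrightarrow> R e \<and> (\<forall>i\<in>{..<e}. greedy R C i \<longrightarrow> \<not> C e i)"

declare greedy.simps [simp del]

lemma greedy_disjoint:
  assumes "greedy R C e" "greedy R C e'" "C e e'" "C e' e"
  shows "e = e'"
proof (rule ccontr)
  assume "e \<noteq> e'"
  then consider "e < e'" | "e' < e" by linarith
  then show False using assms by cases (metis greedy.simps lessThan_iff)+
qed

lemma greedy_maximal:
  assumes "R e"
  shows "greedy R C e \<or> (\<exists>i. greedy R C i \<and> C e i)"
  using assms by (subst greedy.simps) blast

text \<open>Course-of-values recursion is replaced by a finite certificate: a set obeying the
  recursion locally at every \<open>i \<le> e\<close> agrees with the selection up to
  \<open>e\<close>, by strong induction.\<close>

lemma greedy_iff_code:
  "greedy R C e \<longleftrightarrow> (\<exists>A. e \<in> set_decode A \<and>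
    (\<forall>i<Suc e. i \<in> set_decode A \<longleftrightarrow> R i \<and> (\<forall>i'<i. i' \<in> set_decode A \<longrightarrow> \<not> C i i')))"
proof
  assume e: "greedy R C e"
  let ?A = "set_encode {i. i < Suc e \<and> greedy R C i}"
  have A: "i \<in> set_decode ?A \<longleftrightarrow> i < Suc e \<and> greedy R C i" for i
    by simp
  have "i \<in> set_decode ?A \<longleftrightarrow> R i \<and> (\<forall>i'<i. i' \<in> set_decode ?A \<longrightarrow> \<not> C i i')" if "i < Suc e" for i
    unfolding A using that greedy.simps[of R C i] by auto
  moreover have "e \<in> set_decode ?A" using e A by simp
  ultimately show "\<exists>A. e \<in> set_decode A \<and>
    (\<forall>i<Suc e. i \<in> set_decode A \<longleftrightarrow> R i \<and> (\<forall>i'<i. i' \<in> set_decode A \<longrightarrow> \<not> C i i'))" by blast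
next
  assume "\<exists>A. e \<in> set_decode A \<and>
    (\<forall>i<Suc e. i \<in> set_decode A \<longleftrightarrow> R i \<and> (\<forall>i'<i. i' \<in> set_decode A \<longrightarrow> \<not> C i i'))"
  then obtain A where A: "e \<in> set_decode A"
    "\<And>i. i < Suc e \<Longrightarrow> i \<in> set_decode A \<longleftrightarrow> R i \<and> (\<forall>i'<i. i' \<in> set_decode A \<longrightarrow> \<not> C i i')"
    by blast
  have "i < Suc e \<Longrightarrow> i \<in> set_decode A \<longleftrightarrow> greedy R C i" for i
  proof (induction i rule: less_induct)
    case (less i)
    then show ?case using A(2)[of i] greedy.simps[of R C i] by auto
  qed
  then show "greedy R C e" using A(1) by simp
qed

section \<open>The adversarial machine\<close>

text \<open>An edge \<^term>\<open>e\<close> codes two endpoints together with two stages at which the approximation is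
  compared with the threshold \<open>2/3\<close>.\<close>

abbreviation endA :: "nat \<Rightarrow> nat" where "endA e \<equiv> pr1 e"
abbreviation endB :: "nat \<Rightarrow> nat" where "endB e \<equiv> pr1 (pr2 e)"
abbreviation stage1 :: "nat \<Rightarrow> nat" where "stage1 e \<equiv> pr1 (pr2 (pr2 e))"
abbreviation stage2 :: "nat \<Rightarrow> nat" where "stage2 e \<equiv> pr2 (pr2 (pr2 e))"

definition touching :: "nat \<Rightarrow> nat \<Rightarrow> bool" where
  "touching e e' \<longleftrightarrow> endA e = endA e' \<or> endA e = endB e' \<or> endB e = endA e' \<or> endB e = endB e'"

text \<open>The half-length \<open>n\<close> is \<open>40 * j\<close>, and \<open>uv\<close> is
  represented by the number \<open>u * base j + v\<close>. The factor 40 dwarfs a program overhead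
  of about \<open>5 * j\<close>: the ratios 45/80 and 40/45 lie on opposite sides of 2/3.\<close>

abbreviation base :: "nat \<Rightarrow> nat" where "base j \<equiv> 2 ^ (40 * j)"

text \<open>\<^term>\<open>F x y s\<close> is the code of the \<^term>\<open>s\<close>-th approximation at the strings with codes
  \<^term>\<open>x\<close> and \<^term>\<open>y\<close>.\<close>

locale approximation =
  fixes F :: "nat \<Rightarrow> nat \<Rightarrow> nat \<Rightarrow> nat"
  assumes computable_F: "computable_in (\<lambda>(x, y, s). [x, y, s]) (\<lambda>(x, y, s). F x y s)"
begin

text \<open>If the approximation first descends and then ascends, this observation shows that the
  ascent has begun by \<open>stage2\<close>, so the limit must exceed 2/3.\<close>

definition rises :: "nat \<Rightarrow> nat \<Rightarrow> nat \<Rightarrow> bool" where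
  "rises j u e \<longleftrightarrow> endA e < base j \<and> endB e < base j \<and> stage1 e < stage2 e \<and>
    rat_of_code (F (u * base j + endA e) (u * base j + endB e) (stage1 e)) < 2 / 3 \<and>
    2 / 3 < rat_of_code (F (u * base j + endA e) (u * base j + endB e) (stage2 e))"

text \<open>Here \<^term>\<open>c\<close> codes a triple \<^term>\<open>(u, S, s)\<close>.\<close>

definition low_clique :: "nat \<Rightarrow> nat \<Rightarrow> bool" where
  "low_clique j c \<longleftrightarrow> pr1 c < base j \<and>
    3 * base j \<le> 4 * card {v. v < base j \<and> v \<in> set_decode (pr1 (pr2 c))} \<and>
    (\<forall>v<base j. v \<in> set_decode (pr1 (pr2 c)) \<longrightarrow>
      (\<forall>w<base j. w \<in> set_decode (pr1 (pr2 c)) \<longrightarrow>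
        (\<exists>t<pr2 (pr2 c). rat_of_code (F (pr1 c * base j + v) (pr1 c * base j + w) t) < 2 / 3)))"

text \<open>Taking the least code singles out one prefix for each \<open>j\<close>, which keeps the
  machine single-valued.\<close>

definition first_clique :: "nat \<Rightarrow> nat \<Rightarrow> bool" where
  "first_clique j c \<longleftrightarrow> low_clique j c \<and> (\<forall>c'<c. \<not> low_clique j c')"

definition matched :: "nat \<Rightarrow> nat \<Rightarrow> nat \<Rightarrow> nat \<Rightarrow> nat \<Rightarrow> bool" where
  "matched j u e x y \<longleftrightarrow> (y = u * base j + endA e \<and> x = u * base j + endB e \<or>
    y = u * base j + endB e \<and> x = u * base j + endA e)"

text \<open>The payload is a whole string for \<open>t = 0\<close>, half a string for
  \<open>t = 1\<close> and \<open>t = 2\<close>, and empty for \<open>t = 3\<close>, where the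
  condition determines the output.\<close>

definition plen :: "nat \<Rightarrow> nat \<Rightarrow> nat" where
  "plen j t = (if t = 0 then 80 * j else if t = 3 then 0 else 40 * j)"

text \<open>The programs \<open>1\<^bsup>4j+t\<^esup> 0 w\<close> with \<open>t < 4\<close>: \<open>t = 0\<close> prints a string literally, \<open>t = 1\<close> replaces
  the second half of the condition, \<open>t = 2\<close> makes every extension of the prefix of the first clique
  cheap, and \<open>t = 3\<close> sends a string to its partner in the greedy matching.\<close>

definition outputs :: "nat \<Rightarrow> nat \<Rightarrow> nat \<Rightarrow> nat \<Rightarrow> nat \<Rightarrow> bool" where
  "outputs j t b y x \<longleftrightarrow>
    t = 0 \<and> x = b \<or>
    t = 1 \<and> x = y div base j * base j + b \<or>
    t = 2 \<and> (\<exists>c. first_clique j c \<and> x = pr1 c * base j + b) \<or>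
    t = 3 \<and> (\<exists>c e. first_clique j c \<and> greedy (rises j (pr1 c)) touching e \<and> matched j (pr1 c) e x y)"

definition runs :: "bool list \<Rightarrow> nat \<Rightarrow> nat \<Rightarrow> bool" where
  "runs p y x \<longleftrightarrow> (\<exists>j t b. t < 4 \<and> b < 2 ^ plen j t \<and> p = prog (4 * j + t) (plen j t) b \<and> outputs j t b y x)"

definition mach :: machine where
  "mach p y = (if \<exists>x. runs p (bits_code y) x then Some (string_of (THE x. runs p (bits_code y) x)) else None)"

section \<open>Single-valuedness and prefix-freeness of the machine\<close>

lemma first_clique_unique: "first_clique j c \<Longrightarrow> first_clique j c' \<Longrightarrow> c = c'"
  unfolding first_clique_def by (metis linorder_neqE_nat)

text \<open>Two selected edges that both have \<open>y\<close> as an endpoint touch, hence coincide;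
  so a partner can be printed without payload.\<close>

lemma matched_functional:
  assumes e: "greedy (rises j u) touching e" "matched j u e x y"
    and e': "greedy (rises j u) touching e'" "matched j u e' x' y"
  shows "x = x'"
proof -
  have "touching e e'" "touching e' e"
    using e(2) e'(2) unfolding matched_def touching_def by auto
  then have "e = e'" using greedy_disjoint e(1) e'(1) by blast
  then show ?thesis using e(2) e'(2) unfolding matched_def by auto
qed

lemma outputs_functional:
  assumes "outputs j t b y x" "outputs j t b y x'"
  shows "x = x'"
proof -
  consider "t = 0" | "t = 1" | "t = 2" | "t = 3" using assms(1) unfolding outputs_def by blast
  then show ?thesis
  proof cases
    case 3
    then obtain c c' where "first_clique j c" "first_clique j c'"
      "x = pr1 c * base j + b" "x' = pr1 c' * base j + b"
      using assms unfolding outputs_def by auto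
    then show ?thesis using first_clique_unique by metis
  next
    case 4
    then obtain c e c' e' where "first_clique j c" "first_clique j c'"
      "greedy (rises j (pr1 c)) touching e" "matched j (pr1 c) e x y"
      "greedy (rises j (pr1 c')) touching e'" "matched j (pr1 c') e' x' y"
      using assms unfolding outputs_def by auto
    then show ?thesis using first_clique_unique matched_functional by metis
  qed (use assms in \<open>simp_all add: outputs_def\<close>)
qed

text \<open>The unary count \<open>4 * j + t\<close> with \<open>t < 4\<close> reveals
  \<open>j\<close> and \<open>t\<close>, hence the payload length; a proper extension would have the
  wrong length.\<close>

lemma runs_prefix_free:
  assumes "runs p y x" "runs (p @ r) y x'"
  shows "r = [] \<and> x = x'"
proof -
  from assms obtain j t b j' t' b' where
    p: "t < 4" "b < 2 ^ plen j t" "p = prog (4 * j + t) (plen j t) b" "outputs j t b y x" and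
    p': "t' < 4" "b' < 2 ^ plen j' t'" "p @ r = prog (4 * j' + t') (plen j' t') b'" "outputs j' t' b' y x'"
    unfolding runs_def by blast
  have eq: "4 * j + t = 4 * j' + t'"
    "word (plen j t) b @ r = word (plen j' t') b'"
    using prog_append_eq p(3) p'(3) by metis+
  have "j = j'" using eq(1) p(1) p'(1) by linarith
  moreover from this have "t = t'" using eq(1) by simp
  ultimately have jt: "j = j'" "t = t'" by simp_all
  have "length r = 0" using arg_cong[OF eq(2), of length] p(2) p'(2) jt by (simp add: length_word)
  moreover from this have "b = b'" using eq(2) jt by (simp add: word_eq_iff)
  ultimately show ?thesis using outputs_functional p(4) p'(4) jt by simp
qed

lemma runs_functional: "runs p y x \<Longrightarrow> runs p y x' \<Longrightarrow> x = x'"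
  using runs_prefix_free[of p y x "[]" x'] by simp

lemma mach_eq_Some_iff: "mach p y = Some z \<longleftrightarrow> runs p (bits_code y) (bits_code z)"
proof
  assume "mach p y = Some z"
  then obtain x where x: "runs p (bits_code y) x" "z = string_of (THE x. runs p (bits_code y) x)"
    unfolding mach_def by (auto split: if_splits)
  then show "runs p (bits_code y) (bits_code z)"
    using the_equality[of "runs p (bits_code y)", OF x(1) runs_functional[OF _ x(1)]] by simp
next
  assume *: "runs p (bits_code y) (bits_code z)"
  then show "mach p y = Some z"
    using the_equality[of "runs p (bits_code y)", OF * runs_functional[OF _ *]]
    unfolding mach_def by auto
qed

text \<open>Here \<^term>\<open>A\<close> codes the part of the greedy matching enumerated up to \<^term>\<open>e\<close>.\<close>

definition certifies :: "nat \<Rightarrow> nat \<Rightarrow> nat \<Rightarrow> nat \<Rightarrow> nat \<Rightarrow> nat \<Rightarrow> nat \<Rightarrow> nat \<Rightarrow> bool" where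
  "certifies j b c e A x q y \<longleftrightarrow>
      b < 2 ^ (80 * j) \<and> q + 2 = 2 ^ (4 * j) * (2 ^ (80 * j + 1) + 1 + 2 * b) \<and> x = b \<or>
      b < base j \<and> q + 2 = 2 ^ (4 * j + 1) * (2 ^ (40 * j + 1) + 1 + 2 * b) \<and>
        (\<exists>u<Suc y. \<exists>v<base j. y = u * base j + v \<and> x = u * base j + b) \<or>
      b < base j \<and> q + 2 = 2 ^ (4 * j + 2) * (2 ^ (40 * j + 1) + 1 + 2 * b) \<and>
        first_clique j c \<and> x = pr1 c * base j + b \<or>
      q + 2 = 2 ^ (4 * j + 3) * 3 \<and> first_clique j c \<and> matched j (pr1 c) e x y \<and> e \<in> set_decode A \<and>
        (\<forall>i<Suc e. i \<in> set_decode A \<longleftrightarrow>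
          rises j (pr1 c) i \<and> (\<forall>i'<i. i' \<in> set_decode A \<longrightarrow> \<not> touching i i'))"

text \<open>One bound \<open>n\<close> on all parameters leaves only bounded quantifiers, as the
  search requires.\<close>

definition witness :: "nat \<Rightarrow> nat \<Rightarrow> nat \<Rightarrow> nat \<Rightarrow> bool" where
  "witness n x q y \<longleftrightarrow> (\<exists>j<n. \<exists>b<n. \<exists>c<n. \<exists>e<n. \<exists>A<n. certifies j b c e A x q y)"

lemma decidable_witness:
  "decidable (\<lambda>z. witness (pr1 z) (pr1 (pr2 z)) (pr1 (pr2 (pr2 z))) (pr2 (pr2 (pr2 z))))"
  unfolding witness_def certifies_def first_clique_def low_clique_def matched_def rises_def touching_def
  by (intro computable_intros decidable_set_decode decidable_rat_of_code
      computable_in_comp3[OF computable_F])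

lemma ex_witness_iff: "(\<exists>n. witness n x q y) \<longleftrightarrow> (\<exists>j b c e A. certifies j b c e A x q y)"
proof
  assume "\<exists>j b c e A. certifies j b c e A x q y"
  then obtain j b c e A where "certifies j b c e A x q y" by blast
  then have "witness (Suc (j + b + c + e + A)) x q y"
    unfolding witness_def
    by (intro exI[of _ j] exI[of _ b] exI[of _ c] exI[of _ e] exI[of _ A] conjI) simp_all
  then show "\<exists>n. witness n x q y" ..
qed (unfold witness_def, blast)

lemma string_of_eq_prog_iff:
  "string_of q = prog k L b \<longleftrightarrow> q + 2 = 2 ^ k * (2 ^ (L + 1) + 1 + 2 * b)"
  unfolding bits_code_prog[symmetric] by (metis add_right_cancel bits_code_string_of string_of_bits_code)

lemma runs_iff_witness: "runs (string_of q) y x \<longleftrightarrow> (\<exists>n. witness n x q y)"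
proof
  assume "runs (string_of q) y x"
  then obtain j t b where t: "t < 4" and b: "b < 2 ^ plen j t"
    and q: "q + 2 = 2 ^ (4 * j + t) * (2 ^ (plen j t + 1) + 1 + 2 * b)" and out: "outputs j t b y x"
    unfolding runs_def string_of_eq_prog_iff by blast
  from out consider "t = 0" "x = b" | "t = 1" "x = y div base j * base j + b"
    | c where "t = 2" "first_clique j c" "x = pr1 c * base j + b"
    | c e where "t = 3" "first_clique j c" "greedy (rises j (pr1 c)) touching e" "matched j (pr1 c) e x y"
    unfolding outputs_def by blast
  then show "\<exists>n. witness n x q y"
  proof cases
    case 1
    then have "certifies j b 0 0 0 x q y"
      unfolding certifies_def using b q by (intro disjI1) (simp add: plen_def)
    then show ?thesis unfolding ex_witness_iff by blast
  next
    case 2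
    \<comment> \<open>A quotient of \<open>y\<close> never exceeds \<open>y\<close>, so a bounded
      search for quotient and remainder replaces division.\<close>
    have "\<exists>u<Suc y. \<exists>v<base j. y = u * base j + v \<and> x = u * base j + b"
    proof -
      have "y div base j < Suc y" by (simp add: less_Suc_eq_le)
      moreover have "y mod base j < base j" by simp
      moreover have "y = y div base j * base j + y mod base j" by (rule div_mult_mod_eq[symmetric])
      ultimately show ?thesis using 2(2) by blast
    qed
    then have "certifies j b 0 0 0 x q y"
      unfolding certifies_def using b q 2(1) by (intro disjI2[OF disjI1] conjI) (simp_all add: plen_def)
    then show ?thesis unfolding ex_witness_iff by blast
  next
    case 3
    then have "certifies j b c 0 0 x q y"
      unfolding certifies_def using b q
      by (intro disjI2[OF disjI2[OF disjI1]] conjI) (simp_all add: plen_def)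
    then show ?thesis unfolding ex_witness_iff by blast
  next
    case 4
    from 4(3) obtain A where "e \<in> set_decode A" "\<forall>i<Suc e. i \<in> set_decode A \<longleftrightarrow>
        rises j (pr1 c) i \<and> (\<forall>i'<i. i' \<in> set_decode A \<longrightarrow> \<not> touching i i')"
      unfolding greedy_iff_code by blast
    \<comment> \<open>An empty payload forces \<open>b = 0\<close>, and the last factor is
      \<open>2 ^ (0 + 1) + 1 = 3\<close>.\<close>
    moreover have "q + 2 = 2 ^ (4 * j + 3) * 3" using b q 4(1) by (simp add: plen_def)
    ultimately have "certifies j b c e A x q y"
      unfolding certifies_def using 4(2,4) by blast
    then show ?thesis unfolding ex_witness_iff by blast
  qed
next
  have run: "runs (string_of q) y x"
    if "t < 4" "b < 2 ^ plen j t" "q + 2 = 2 ^ (4 * j + t) * (2 ^ (plen j t + 1) + 1 + 2 * b)"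
      "outputs j t b y x" for j t b
    unfolding runs_def string_of_eq_prog_iff using that by blast
  assume "\<exists>n. witness n x q y"
  then obtain j b c e A where "certifies j b c e A x q y"
    unfolding ex_witness_iff by blast
  then consider "b < 2 ^ (80 * j)" "q + 2 = 2 ^ (4 * j) * (2 ^ (80 * j + 1) + 1 + 2 * b)" "x = b"
    | u v where "b < base j" "q + 2 = 2 ^ (4 * j + 1) * (2 ^ (40 * j + 1) + 1 + 2 * b)"
      "v < base j" "y = u * base j + v" "x = u * base j + b"
    | "b < base j" "q + 2 = 2 ^ (4 * j + 2) * (2 ^ (40 * j + 1) + 1 + 2 * b)"
      "first_clique j c" "x = pr1 c * base j + b"
    | "q + 2 = 2 ^ (4 * j + 3) * 3" "first_clique j c" "matched j (pr1 c) e x y"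
      "greedy (rises j (pr1 c)) touching e"
    unfolding certifies_def greedy_iff_code by blast
  then show "runs (string_of q) y x"
  proof cases
    case 1
    then show ?thesis by (intro run[of 0 b j]) (simp_all add: plen_def outputs_def)
  next
    case 2
    then show ?thesis by (intro run[of 1 b j]) (simp_all add: plen_def outputs_def)
  next
    case 3
    then show ?thesis by (intro run[of 2 b j]) (auto simp: plen_def outputs_def)
  next
    case 4
    then show ?thesis by (intro run[of 3 0 j]) (auto simp: plen_def outputs_def)
  qed
qed

lemma prefix_free_mach: "prefix_free_machine mach"
proof -
  have "\<exists>r. \<forall>q y v. rec_eval r [q, y] v \<longleftrightarrow> (\<exists>n. witness n v q y)"
    by (rule single_valued_search[OF decidable_witness]) (use runs_iff_witness runs_functional in blast)
  then obtain r where r: "\<And>q y v. rec_eval r [q, y] v \<longleftrightarrow> runs (string_of q) y v"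
    unfolding runs_iff_witness by blast
  have "rec_eval r [bits_code p, bits_code y] v \<longleftrightarrow> (\<exists>x. mach p y = Some x \<and> v = bits_code x)" for p y v
    unfolding r mach_eq_Some_iff by (metis bits_code_string_of string_of_bits_code)
  then have "partial_computable mach" unfolding partial_computable_def by blast
  moreover have "r = []" if "mach p y \<noteq> None" "mach (p @ r) y \<noteq> None" for p y r
    using that runs_prefix_free by (auto simp: mach_eq_Some_iff)
  ultimately show ?thesis unfolding prefix_free_machine_def by blast
qed

end


section \<open>Counting and refutation\<close>

text \<open>Distinct strings have distinct shortest programs, and only \<open>2 ^ m - 1\<close>
  strings are shorter than \<open>m\<close>. The hypothesis ensures that the minimum in
  \<open>Kc\<close> is attained.\<close>

lemma few_simple_strings:
  fixes U :: machine
  assumes prog: "\<And>X. X \<in> A \<Longrightarrow> \<exists>p. U p y = Some (string_of X)"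
  shows "finite {X \<in> A. Kc U (string_of X) y < m}" "card {X \<in> A. Kc U (string_of X) y < m} < 2 ^ m"
proof -
  let ?S = "{X \<in> A. Kc U (string_of X) y < m}"
  define P where "P X = (SOME p. length p = Kc U (string_of X) y \<and> U p y = Some (string_of X))" for X
  have P: "length (P X) = Kc U (string_of X) y \<and> U (P X) y = Some (string_of X)" if X: "X \<in> A" for X
  proof -
    have "\<exists>n p. length p = n \<and> U p y = Some (string_of X)" using prog[OF X] by simp
    then have "\<exists>p. length p = Kc U (string_of X) y \<and> U p y = Some (string_of X)"
      unfolding Kc_def by (rule LeastI_ex)
    then show ?thesis unfolding P_def by (rule someI_ex)
  qed
  have inj: "inj_on (\<lambda>X. bits_code (P X)) ?S"
  proof (rule inj_onI)
    fix X X' assume *: "X \<in> ?S" "X' \<in> ?S" "bits_code (P X) = bits_code (P X')"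
    have "P X = P X'" by (rule injD[OF inj_bits_code *(3)])
    moreover have "X \<in> A" "X' \<in> A" using *(1,2) by simp_all
    ultimately have "Some (string_of X) = Some (string_of X')"
      using P[THEN conjunct2] by metis
    then show "X = X'" by simp
  qed
  have img: "(\<lambda>X. bits_code (P X)) ` ?S \<subseteq> {..<2 ^ m - 1}"
  proof (rule image_subsetI)
    fix X assume "X \<in> ?S"
    then have X: "X \<in> A" "Kc U (string_of X) y < m" by auto
    have "(2 :: nat) ^ Suc (length (P X)) \<le> 2 ^ m"
      using X P[OF X(1)] by (intro power_increasing) auto
    then have "Suc (bits_code (P X)) < 2 ^ m"
      using bits_code_bounds(2)[of "P X"] by (rule order_less_le_trans[rotated])
    then show "bits_code (P X) \<in> {..<2 ^ m - 1}" by (simp add: less_diff_conv)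
  qed
  show "finite ?S" by (rule inj_on_finite[OF inj img]) simp
  have "card ?S \<le> 2 ^ m - 1" using card_inj_on_le[OF inj img] by simp
  moreover have "(1 :: nat) \<le> 2 ^ m" by simp
  ultimately show "card ?S < 2 ^ m" by linarith
qed

lemma fraction_threshold:
  fixes a b :: nat
  shows "3 * a < 2 * b \<Longrightarrow> of_nat a / of_nat b < (2 / 3 :: rat)"
    and "0 < b \<Longrightarrow> 2 * b < 3 * a \<Longrightarrow> (2 / 3 :: rat) < of_nat a / of_nat b"
proof -
  assume "3 * a < 2 * b"
  then have "(of_nat (3 * a) :: rat) < of_nat (2 * b)" "(0 :: rat) < of_nat b"
    by (simp_all only: of_nat_less_iff)
  then show "of_nat a / of_nat b < (2 / 3 :: rat)" by (simp add: field_simps)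
next
  assume "0 < b" "2 * b < 3 * a"
  then have "(of_nat (2 * b) :: rat) < of_nat (3 * a)" "(0 :: rat) < of_nat b"
    by (simp_all only: of_nat_less_iff)
  then show "(2 / 3 :: rat) < of_nat a / of_nat b" by (simp add: field_simps)
qed

text \<open>Here \<open>\<sigma>\<close> is the prefix by which \<open>U\<close> simulates the
  machine, and \<open>stays_high\<close> is the contribution of the \<open>\<Pi>\<^sub>2\<close>
  shape.\<close>

locale NID_approximation = approximation +
  fixes U :: machine and \<sigma> :: "bool list"
  assumes simulates: "\<And>p y. U (\<sigma> @ p) y = mach p y"
    and approximates:
      "\<And>x y. (\<lambda>s. real_of_rat (rat_of_code (F x y s))) \<longlonglongrightarrow> real_of_rat (NID U (string_of x) (string_of y))"
    and stays_high: "\<And>x y s t. s < t \<Longrightarrow> rat_of_code (F x y s) < 2 / 3 \<Longrightarrow> 2 / 3 < rat_of_code (F x y t)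
      \<Longrightarrow> 2 / 3 < NID U (string_of x) (string_of y)"
begin

section \<open>Complexity bounds through the simulated machine\<close>

abbreviation kc :: "nat \<Rightarrow> nat \<Rightarrow> nat" where
  "kc x y \<equiv> Kc U (string_of x) (string_of y)"

text \<open>Code 0 is the empty string, so \<open>kc x 0\<close> is unconditional
  complexity.\<close>

lemma NID_eq: "NID U (string_of x) (string_of y) = of_nat (max (kc x y) (kc y x)) / of_nat (max (kc x 0) (kc y 0))"
  unfolding NID_def E_def K_def by simp

lemma U_prog:
  assumes "t < 4" "b < 2 ^ plen j t" "outputs j t b y x"
  shows "U (\<sigma> @ prog (4 * j + t) (plen j t) b) (string_of y) = Some (string_of x)"
  unfolding simulates mach_eq_Some_iff runs_def using assms by auto

lemma kc_le:
  assumes "t < 4" "b < 2 ^ plen j t" "outputs j t b y x"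
  shows "kc x y \<le> length \<sigma> + (4 * j + t + 1 + plen j t)"
  unfolding Kc_def
  by (rule Least_le, rule exI[of _ "\<sigma> @ prog (4 * j + t) (plen j t) b"])
    (simp add: U_prog[OF assms] length_prog[OF assms(2)])

lemma ex_program:
  assumes "x < 2 ^ (80 * j)"
  shows "\<exists>p. U p (string_of y) = Some (string_of x)"
  using U_prog[of 0 x j y x] assms by (auto simp: plen_def outputs_def)

text \<open>The machine serves every \<open>j\<close> at once, so the parameter can be chosen after
  \<open>\<sigma>\<close>. The bound of \<open>kc_le\<close> becomes
  \<open>5 * J + t + plen J t\<close>.\<close>

definition J :: nat where "J = length \<sigma> + 1"

abbreviation B :: nat where "B \<equiv> base J"

lemma joined_less: "u < B \<Longrightarrow> v < B \<Longrightarrow> u * B + v < 2 ^ (80 * J)"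
proof -
  assume "u < B" "v < B"
  then have "u * B + v < Suc u * B" by simp
  also have "\<dots> \<le> B * B" using \<open>u < B\<close> by (intro mult_right_mono) auto
  also have "B * B = 2 ^ (80 * J)" by (simp add: power_add[symmetric])
  finally show ?thesis .
qed

text \<open>A program with \<open>t = 1\<close> keeps \<open>u\<close> from the condition and
  supplies \<open>v\<close> as payload.\<close>

lemma kc_same_prefix_le:
  assumes "v < B" "w < B"
  shows "kc (u * B + v) (u * B + w) \<le> 45 * J + 1"
  using kc_le[of 1 v J "u * B + w" "u * B + v"] assms by (simp add: plen_def outputs_def J_def)

text \<open>Fewer than \<open>2 ^ (40 * J - 2)\<close> strings are this simple, which is a quarter
  of \<open>B\<close>; the truncated subtraction is exact as \<open>J\<close> is positive.\<close>

lemma few_simple_extensions: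
  assumes "u < B"
  shows "4 * card {v. v < B \<and> kc (u * B + v) y < 40 * J - 2} < B"
proof -
  let ?A = "{X. \<exists>v<B. X = u * B + v}"
  have A: "\<exists>p. U p (string_of y) = Some (string_of X)" if "X \<in> ?A" for X
    using that ex_program joined_less[OF assms] by blast
  have "(\<lambda>v. u * B + v) ` {v. v < B \<and> kc (u * B + v) y < 40 * J - 2} \<subseteq> {X \<in> ?A. kc X y < 40 * J - 2}"
    by auto
  then have "card {v. v < B \<and> kc (u * B + v) y < 40 * J - 2} \<le> card {X \<in> ?A. kc X y < 40 * J - 2}"
    by (intro card_inj_on_le[where f = "\<lambda>v. u * B + v"] few_simple_strings(1)) (auto simp: inj_on_def intro: A)
  also have "\<dots> < 2 ^ (40 * J - 2)" by (intro few_simple_strings(2) A)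
  finally have "4 * card {v. v < B \<and> kc (u * B + v) y < 40 * J - 2} < 2 ^ 2 * 2 ^ (40 * J - 2)"
    by simp
  also have "(2 :: nat) ^ 2 * 2 ^ (40 * J - 2) = B"
    unfolding power_add[symmetric] by (simp add: J_def)
  finally show ?thesis .
qed

text \<open>Averaging: if every prefix had at least \<open>B / 4\<close> simple extensions, there
  would be at least \<open>2 ^ (80 * J - 2)\<close> strings of complexity below
  \<open>80 * J - 2\<close>.\<close>

lemma ex_rich_prefix:
  "\<exists>u<B. 4 * card {v. v < B \<and> kc (u * B + v) 0 < 80 * J - 2} < B"
proof (rule ccontr)
  assume "\<not> ?thesis"
  then have big: "B \<le> 4 * card {v. v < B \<and> kc (u * B + v) 0 < 80 * J - 2}" if "u < B" for u
    using that not_less by blast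
  let ?V = "\<lambda>u. {v. v < B \<and> kc (u * B + v) 0 < 80 * J - 2}"
  let ?S = "{X \<in> {..<2 ^ (80 * J)}. kc X 0 < 80 * J - 2}"
  have "B * B = (\<Sum>u<B. B)" by simp
  also have "\<dots> \<le> (\<Sum>u<B. 4 * card (?V u))" by (intro sum_mono big) simp
  also have "\<dots> = 4 * card (SIGMA u:{..<B}. ?V u)"
    by (simp add: sum_distrib_left)
  also have "card (SIGMA u:{..<B}. ?V u) \<le> card ?S"
  proof (rule card_inj_on_le[where f = "\<lambda>(u, v). u * B + v"])
    show "inj_on (\<lambda>(u, v). u * B + v) (SIGMA u:{..<B}. ?V u)"
    proof (rule inj_onI, clarsimp)
      fix u v u' v' assume *: "v < B" "v' < B" "u * B + v = u' * B + v'"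
      have "(u * B + v) div B = (u' * B + v') div B" "(u * B + v) mod B = (u' * B + v') mod B"
        using *(3) by simp_all
      then show "u = u' \<and> v = v'" using *(1,2) by simp
    qed
    show "(\<lambda>(u, v). u * B + v) ` (SIGMA u:{..<B}. ?V u) \<subseteq> ?S"
      using joined_less by auto
    show "finite ?S" by simp
  qed
  also have "card ?S < 2 ^ (80 * J - 2)"
    by (rule few_simple_strings(2)) (rule ex_program, simp)
  finally have "B * B < 2 ^ 2 * 2 ^ (80 * J - 2)" by simp
  also have "(2 :: nat) ^ 2 * 2 ^ (80 * J - 2) = B * B"
    unfolding power_add[symmetric] by (simp add: J_def)
  finally show False by simp
qed

section \<open>Observing the approximation and deriving the contradiction\<close>

lemma eventually_low:
  assumes "NID U (string_of x) (string_of y) < 2 / 3"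
  shows "\<exists>s. rat_of_code (F x y s) < 2 / 3"
proof -
  have "real_of_rat (NID U (string_of x) (string_of y)) < real_of_rat (2 / 3)"
    using assms by (simp only: of_rat_less)
  from order_tendstoD(2)[OF approximates this] obtain s
    where "real_of_rat (rat_of_code (F x y s)) < real_of_rat (2 / 3)"
    by (meson eventually_sequentially order_refl)
  then show ?thesis by (auto simp only: of_rat_less)
qed

text \<open>The stage can be taken beyond any \<open>s0\<close>, in particular after an observed low
  value.\<close>

lemma eventually_high:
  assumes "2 / 3 < NID U (string_of x) (string_of y)"
  shows "\<exists>s>s0. 2 / 3 < rat_of_code (F x y s)"
proof -
  have "real_of_rat (2 / 3) < real_of_rat (NID U (string_of x) (string_of y))"
    using assms by (simp only: of_rat_less)
  from order_tendstoD(1)[OF approximates this] obtain N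
    where "\<And>s. N \<le> s \<Longrightarrow> real_of_rat (2 / 3) < real_of_rat (rat_of_code (F x y s))"
    by (auto simp: eventually_sequentially)
  then have "2 / 3 < rat_of_code (F x y (N + Suc s0))" by (simp only: of_rat_less le_add1)
  then show ?thesis by (intro exI[of _ "N + Suc s0"]) simp
qed

text \<open>The complex extensions of a rich prefix form a clique, since
  \<open>3 * (45 * J + 1) < 2 * (80 * J - 2)\<close> puts their NID below 2/3.\<close>

lemma ex_low_clique: "\<exists>c. low_clique J c"
proof -
  obtain u where u: "u < B" "4 * card {v. v < B \<and> kc (u * B + v) 0 < 80 * J - 2} < B"
    using ex_rich_prefix by blast
  define V where "V = {v. v < B \<and> \<not> kc (u * B + v) 0 < 80 * J - 2}"
  have fin: "finite V" unfolding V_def by simp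
  have V: "{v. v < B \<and> v \<in> V} = V" unfolding V_def by auto
  have "card (V \<union> {v. v < B \<and> kc (u * B + v) 0 < 80 * J - 2}) =
      card V + card {v. v < B \<and> kc (u * B + v) 0 < 80 * J - 2}"
    by (rule card_Un_disjoint) (auto simp: V_def)
  also have "V \<union> {v. v < B \<and> kc (u * B + v) 0 < 80 * J - 2} = {v. v < B}" by (auto simp: V_def)
  also have "card {v. v < B} = B" by (rule card_Collect_less_nat)
  finally have card: "3 * B \<le> 4 * card V" using u(2) by linarith
  have "\<exists>s. rat_of_code (F (u * B + v) (u * B + w) s) < 2 / 3" if "v \<in> V" "w \<in> V" for v w
  proof (rule eventually_low)
    have "v < B" "w < B" "80 * J - 2 \<le> kc (u * B + v) 0" using that unfolding V_def by auto
    moreover have "1 \<le> J" by (simp add: J_def)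
    ultimately show "NID U (string_of (u * B + v)) (string_of (u * B + w)) < 2 / 3"
      unfolding NID_eq using kc_same_prefix_le[of v w u] kc_same_prefix_le[of w v u]
      by (intro fraction_threshold(1)) linarith
  qed
  then obtain s where s: "\<And>v w. v \<in> V \<Longrightarrow> w \<in> V \<Longrightarrow> rat_of_code (F (u * B + v) (u * B + w) (s v w)) < 2 / 3"
    by metis
  \<comment> \<open>Finiteness of \<open>V\<close> gives one bound for all pairs; the successor
    makes it strict.\<close>
  define t where "t = Suc (Max ((\<lambda>(v, w). s v w) ` (V \<times> V)))"
  have t: "s v w < t" if "v \<in> V" "w \<in> V" for v w
    unfolding t_def less_Suc_eq_le using fin that by (intro Max_ge) auto
  have "\<exists>s<t. rat_of_code (F (u * B + v) (u * B + w) s) < 2 / 3" if "v \<in> V" "w \<in> V" for v w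
    using s[OF that] t[OF that] by blast
  then have "low_clique J (pair u (pair (set_encode V) t))"
    unfolding low_clique_def using u(1) card by (simp add: fin V)
  then show ?thesis ..
qed

lemma contradiction: False
proof -
  \<comment> \<open>The first clique need not be the one just constructed; only its size and the
    observed low values are used.\<close>
  define c where "c = (LEAST c. low_clique J c)"
  have "low_clique J c" unfolding c_def by (rule LeastI_ex[OF ex_low_clique])
  then have first: "first_clique J c"
    unfolding first_clique_def c_def using not_less_Least by blast
  define u where "u = pr1 c"
  define V where "V = {v. v < B \<and> v \<in> set_decode (pr1 (pr2 c))}"
  have u: "u < B" and card: "3 * B \<le> 4 * card V"
    and low: "\<And>v w. v \<in> V \<Longrightarrow> w \<in> V \<Longrightarrow> \<exists>t. rat_of_code (F (u * B + v) (u * B + w) t) < 2 / 3"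
    using \<open>low_clique J c\<close> unfolding low_clique_def u_def V_def by blast+
  have J: "1 \<le> J" by (simp add: J_def)
  let ?G = "greedy (rises J u) touching"
  define M where "M = {v. \<exists>e. ?G e \<and> (v = endA e \<or> v = endB e)}"
  \<comment> \<open>Otherwise two unmatched strings would have NID above 2/3, their pair would be
    seen to rise, and maximality of the matching would cover one of them.\<close>
  have unmatched: "2 * card (V - M) < B"
  proof (rule ccontr)
    assume big: "\<not> ?thesis"
    have "V - M \<noteq> {}"
    proof
      assume "V - M = {}"
      then show False using big by (simp only: card.empty) simp
    qed
    then obtain w where w: "w \<in> V" "w \<notin> M" by blast
    let ?N1 = "{v. v < B \<and> kc (u * B + v) 0 < 40 * J - 2}"
    let ?N2 = "{v. v < B \<and> kc (u * B + v) (u * B + w) < 40 * J - 2}"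
    \<comment> \<open>Each set has fewer than \<open>B / 4\<close> elements. Avoiding
      \<open>?N2\<close> makes the numerator of NID large; avoiding \<open>?N1\<close> makes its
      denominator positive.\<close>
    have "card (?N1 \<union> ?N2) \<le> card ?N1 + card ?N2" by (rule card_Un_le)
    then have "2 * card (?N1 \<union> ?N2) < B"
      using few_simple_extensions[OF u, of 0] few_simple_extensions[OF u, of "u * B + w"] by linarith
    then have "\<not> V - M \<subseteq> ?N1 \<union> ?N2" using big card_mono[of "?N1 \<union> ?N2" "V - M"] by auto
    then obtain v where v: "v \<in> V" "v \<notin> M" "v \<notin> ?N1" "v \<notin> ?N2" by blast
    have less: "v < B" "w < B" using v(1) w(1) unfolding V_def by auto
    let ?x = "u * B + v" and ?y = "u * B + w"
    have "kc (u * B + b) 0 \<le> 45 * J + 2" if "b < B" for b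
    proof -
      have "outputs J 2 b 0 (u * B + b)" unfolding outputs_def u_def using first by blast
      from kc_le[OF _ _ this] show ?thesis using that by (simp add: plen_def J_def)
    qed
    then have "kc ?x 0 \<le> 45 * J + 2" "kc ?y 0 \<le> 45 * J + 2" using less by auto
    moreover have "40 * J - 2 \<le> kc ?x 0" "40 * J - 2 \<le> kc ?x ?y" using v(3,4) less by auto
    \<comment> \<open>The programs with \<open>t = 2\<close> cap the denominator, and
      \<open>2 * (45 * J + 2) < 3 * (40 * J - 2)\<close>.\<close>
    ultimately have "2 / 3 < NID U (string_of ?x) (string_of ?y)"
      unfolding NID_eq using J by (intro fraction_threshold(2)) linarith+
    moreover obtain s where s: "rat_of_code (F ?x ?y s) < 2 / 3" using low[OF v(1) w(1)] by blast
    ultimately obtain t where "s < t" "2 / 3 < rat_of_code (F ?x ?y t)" using eventually_high by blast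
    then have "rises J u (pair v (pair w (pair s t)))" unfolding rises_def using less s by simp
    then obtain e where e: "?G e" "e = pair v (pair w (pair s t)) \<or> touching (pair v (pair w (pair s t))) e"
      using greedy_maximal by blast
    then show False using v(2) w(2) unfolding M_def touching_def by auto
  qed
  let ?N = "{v. v < B \<and> kc (u * B + v) 0 < 40 * J - 2}"
  have "card V \<le> card (V \<inter> M) + card (V - M)"
    by (metis card_Un_le Int_Diff_Un)
  \<comment> \<open>More than \<open>3 / 4 - 1 / 2\<close> of all \<open>B\<close> extensions are
    matched, and fewer than a quarter are simple.\<close>
  then have "card ?N < card (V \<inter> M)"
    using few_simple_extensions[OF u, of 0] unmatched card by linarith
  then have "\<not> V \<inter> M \<subseteq> ?N" using card_mono[of ?N "V \<inter> M"] by auto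
  then obtain v where v: "v < B" "v \<in> M" "40 * J - 2 \<le> kc (u * B + v) 0"
    unfolding V_def using not_less by blast
  then obtain e where e: "?G e" "v = endA e \<or> v = endB e" unfolding M_def by blast
  let ?x = "u * B + endA e" and ?y = "u * B + endB e"
  have partner: "kc x y \<le> 5 * J + 3" if "matched J u e x y" for x y
  proof -
    have "outputs J 3 0 y x" unfolding outputs_def using first e(1) that unfolding u_def by blast
    from kc_le[OF _ _ this] show ?thesis by (simp add: plen_def J_def)
  qed
  have "kc ?x ?y \<le> 5 * J + 3" "kc ?y ?x \<le> 5 * J + 3"
    by (rule partner, simp add: matched_def)+
  moreover have "40 * J - 2 \<le> max (kc ?x 0) (kc ?y 0)" using v(3) e(2) by auto
  \<comment> \<open>Matching made \<open>E\<close> at most \<open>5 * J + 3\<close>, while one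
    endpoint still has complexity at least \<open>40 * J - 2\<close>.\<close>
  ultimately have "NID U (string_of ?x) (string_of ?y) < 2 / 3"
    unfolding NID_eq using J by (intro fraction_threshold(1)) linarith
  moreover have "rises J u e" using e(1) greedy.simps by blast
  then have "2 / 3 < NID U (string_of ?x) (string_of ?y)"
    unfolding rises_def using stays_high by blast
  ultimately show False by simp
qed

end

section \<open>From an arbitrary approximation to the refuted setting\<close>

theorem mainTheorem8:
  assumes "universal_pf_machine U"
  shows "\<not> in_Pi2 (NID U)"
proof
  assume "in_Pi2 (NID U)"
  then obtain f where comp: "computable_approx f"
    and lim: "\<And>x y. (\<lambda>s. real_of_rat (f x y s)) \<longlonglongrightarrow> real_of_rat (NID U x y)"
    and shape: "\<And>x y. \<exists>s0. (\<forall>t t'. t \<le> t' \<longrightarrow> t' < s0 \<longrightarrow> f x y t' \<le> f x y t) \<and>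
        (\<forall>t t'. s0 \<le> t \<longrightarrow> t \<le> t' \<longrightarrow> f x y t \<le> f x y t')"
    unfolding in_Pi2_def by blast
  from comp obtain r where "\<And>x y s. \<exists>v. rec_eval r [bits_code x, bits_code y, s] v \<and> f x y s = rat_of_code v"
    unfolding computable_approx_def by blast
  then have "\<exists>v. rec_eval r [x, y, s] v \<and> f (string_of x) (string_of y) s = rat_of_code v" for x y s
    \<comment> \<open>Every number codes a string, so the approximation can be read on
      codes.\<close>
    by (metis bits_code_string_of)
  then obtain F where F: "\<And>x y s. rec_eval r [x, y, s] (F x y s)"
    "\<And>x y s. f (string_of x) (string_of y) s = rat_of_code (F x y s)"
    by metis
  interpret approximation F
    by standard (auto simp: computable_in_def intro: F(1))
  obtain \<sigma> where \<sigma>: "\<And>p y. U (\<sigma> @ p) y = mach p y"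
    using assms prefix_free_mach unfolding universal_pf_machine_def by blast
  have high: "2 / 3 < NID U (string_of x) (string_of y)"
    if st: "s < t" "rat_of_code (F x y s) < 2 / 3" "2 / 3 < rat_of_code (F x y t)" for x y s t
  proof -
    let ?f = "f (string_of x) (string_of y)"
    obtain s0 where s0: "\<And>t t'. t \<le> t' \<Longrightarrow> t' < s0 \<Longrightarrow> ?f t' \<le> ?f t"
      "\<And>t t'. s0 \<le> t \<Longrightarrow> t \<le> t' \<Longrightarrow> ?f t \<le> ?f t'"
      using shape[of "string_of x" "string_of y"] by blast
    \<comment> \<open>A strict increase from \<open>s\<close> to \<open>t\<close> cannot lie within
      the descending phase; from \<open>t\<close> on the values only grow, so the limit is at least
      the value at \<open>t\<close>.\<close>
    have "s0 \<le> t"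
      using s0(1)[of s t] st unfolding F(2) by (meson leI less_imp_le less_trans not_less)
    then have "real_of_rat (?f t) \<le> real_of_rat (?f t')" if "t \<le> t'" for t'
      using s0(2) that by (simp only: of_rat_less_eq)
    then have "real_of_rat (?f t) \<le> real_of_rat (NID U (string_of x) (string_of y))"
      by (intro LIMSEQ_le_const[OF lim] exI[of _ t]) blast
    then have "?f t \<le> NID U (string_of x) (string_of y)" by (simp only: of_rat_less_eq)
    then show ?thesis using st(3) unfolding F(2) by linarith
  qed
  interpret NID_approximation F U \<sigma>
    using \<sigma> lim[of "string_of _" "string_of _", unfolded F(2)] high by unfold_locales
  show False by (rule contradiction)
qed

end
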